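(* For $n\ge 1$, \[ \sum_{\sigma\in\mathfrak{S}_n} (-1)^{\mathsf{inv}(\sigma)} s^{\mathsf{exc}(\sigma)} t^{\mathsf{depth}(\sigma)}=(1-st)^{n-1}. \]
   Context: $\mathfrak{S}_n$ is the symmetric group of permutations $\sigma=\sigma(1)\cdots\sigma(n)$ of $[n]=\{1,\dots,n\}$. $\mathsf{inv}(\sigma)$ is the number of pairs $(i,j)$ with $1\le i<j\le n$ and $\sigma(i)>\sigma(j)$. $\mathsf{exc}(\sigma)$ is the number of indices $i$ with $\sigma(i)>i$. $\mathsf{depth}(\sigma)=\sum_{i:\sigma(i)>i}(\sigma(i)-i)$. $s,t$ are indeterminates. *)

theory Defs
  imports "HOL-Combinatorics.Permutations" "HOL-Computational_Algebra.Polynomial"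
begin

text \<open>Permutations of \<open>[n]\<close> are functions \<open>\<sigma> :: nat \<Rightarrow> nat\<close> with
  \<open>\<sigma> permutes {1..n}\<close>, so they are the identity outside \<open>{1..n}\<close>.\<close>

definition inversions :: "nat \<Rightarrow> (nat \<Rightarrow> nat) \<Rightarrow> nat" where
  "inversions n \<sigma> = card {(i, j). 1 \<le> i \<and> i < j \<and> j \<le> n \<and> \<sigma> i > \<sigma> j}"

definition exc :: "nat \<Rightarrow> (nat \<Rightarrow> nat) \<Rightarrow> nat" where
  "exc n \<sigma> = card {i \<in> {1..n}. \<sigma> i > i}"

definition depth :: "nat \<Rightarrow> (nat \<Rightarrow> nat) \<Rightarrow> nat" where
  "depth n \<sigma> = (\<Sum>i | i \<in> {1..n} \<and> \<sigma> i > i. \<sigma> i - i)"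

text \<open>The ring \<open>\<int>[s, t]\<close> is represented as \<open>\<int>[s][t]\<close>: the inner variable is \<open>s\<close>,
  the outer one is \<open>t\<close>.\<close>

definition var_s :: "int poly poly" where
  "var_s = [:[:0, 1:]:]"

definition var_t :: "int poly poly" where
  "var_t = [:0, 1:]"

end

theory Submission
  imports Defs
begin

text \<open>The sum is the determinant of the matrix with entry \<open>s t\<^sup>j\<^sup>-\<^sup>i\<close> above
  the diagonal (\<open>i < j\<close>) and \<open>1\<close> elsewhere. Its last two rows differ only in the last column,
  by \<open>1 - s t\<close>. In terms of permutations of \<open>[n + 1]\<close>: composition with the transposition of \<open>n\<close>
  and \<open>n + 1\<close> reverses the sign. It preserves the weight unless \<open>n + 1\<close> is the
  value at position \<open>n\<close> or \<open>n + 1\<close>, so all other terms cancel. The permutations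
  fixing \<open>n + 1\<close> contribute the sum for \<open>n\<close>, and their partners contribute \<open>- s t\<close> times it.\<close>

lemma finite_inversions:
  "finite {(i, j). (1 :: nat) \<le> i \<and> i < j \<and> j \<le> n \<and> (\<sigma> i :: nat) > \<sigma> j}"
  by (rule finite_subset[of _ "{1..n} \<times> {1..n}"]) auto

text \<open>Since \<open>k\<close> and \<open>Suc k\<close> are neighbours, the transposition
  preserves the order of every pair of positions \<open>i < j\<close> other than
  \<open>(k, Suc k)\<close>. Applied to both positions, it thus carries the inversions of
  \<open>\<sigma>\<close> bijectively to those of the composite other than
  \<open>(k, Suc k)\<close>.\<close>

lemma inversions_adjacent_swap:
  assumes k: "1 \<le> k" "Suc k \<le> n" and less: "\<sigma> k < \<sigma> (Suc k)"
  shows "inversions n (\<sigma> \<circ> transpose k (Suc k)) = Suc (inversions n \<sigma>)"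
proof -
  let ?\<tau> = "transpose k (Suc k)"
  let ?I = "\<lambda>\<sigma>. {(i, j). 1 \<le> i \<and> i < j \<and> j \<le> n \<and> (\<sigma> i :: nat) > \<sigma> j}"
  have mem: "(?\<tau> i, ?\<tau> j) \<in> ?I (\<sigma> \<circ> ?\<tau>)" if "(i, j) \<in> ?I \<sigma>" for i j
    using that k less by (auto simp: transpose_def)
  have mem': "(?\<tau> i, ?\<tau> j) \<in> ?I \<sigma>" if "(i, j) \<in> ?I (\<sigma> \<circ> ?\<tau>)" "(i, j) \<noteq> (k, Suc k)" for i j
    using that k less by (auto simp: transpose_def split: if_splits)
  have "?I (\<sigma> \<circ> ?\<tau>) = insert (k, Suc k) (map_prod ?\<tau> ?\<tau> ` ?I \<sigma>)" (is "?L = ?R")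
  proof
    show "?L \<subseteq> ?R"
    proof
      fix p assume p: "p \<in> ?L"
      obtain i j where ij: "p = (i, j)" by (cases p)
      show "p \<in> ?R"
      proof (cases "p = (k, Suc k)")
        case False
        then have "(?\<tau> i, ?\<tau> j) \<in> ?I \<sigma>" using mem' p ij by blast
        moreover have "p = map_prod ?\<tau> ?\<tau> (?\<tau> i, ?\<tau> j)" by (simp add: ij)
        ultimately show ?thesis by blast
      qed simp
    qed
    show "?R \<subseteq> ?L"
    proof (intro insert_subsetI image_subsetI)
      show "(k, Suc k) \<in> ?L" using k less by simp
    next
      fix p assume p: "p \<in> ?I \<sigma>"
      obtain i j where ij: "p = (i, j)" by (cases p)
      show "map_prod ?\<tau> ?\<tau> p \<in> ?L"
        using mem[of i j] p unfolding ij map_prod_simp by blast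
    qed
  qed
  \<comment> \<open>Its only preimage is \<open>(Suc k, k)\<close>, which is not increasing.\<close>
  moreover have "(k, Suc k) \<notin> map_prod ?\<tau> ?\<tau> ` ?I \<sigma>"
    by (auto simp: transpose_def split: if_splits)
  moreover have "inj_on (map_prod ?\<tau> ?\<tau>) (?I \<sigma>)"
    by (rule inj_on_subset[OF prod.inj_map]) auto
  ultimately show ?thesis
    unfolding inversions_def
    by (simp only: card_insert_disjoint card_image finite_imageI finite_inversions not_False_eq_True)
qed

lemma inversions_Suc_permutes:
  assumes "\<sigma> permutes {1..n}"
  shows "inversions (Suc n) \<sigma> = inversions n \<sigma>"
proof -
  have "\<sigma> i \<le> Suc n" if "i \<le> n" for i
    using permutes_in_image[OF assms, of i] permutes_not_in[OF assms, of i] that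
    by (cases "i = 0") auto
  then have "\<not> \<sigma> i > Suc n" if "i \<le> n" for i
    using that by (simp add: not_less)
  moreover have "\<sigma> (Suc n) = Suc n"
    using assms by (rule permutes_not_in) simp
  ultimately have "{(i, j). 1 \<le> i \<and> i < j \<and> j \<le> Suc n \<and> \<sigma> i > \<sigma> j}
      = {(i, j). 1 \<le> i \<and> i < j \<and> j \<le> n \<and> \<sigma> i > \<sigma> j}"
    by (auto simp: le_Suc_eq)
  then show ?thesis
    by (simp add: inversions_def)
qed

lemma power_minus_one_inversions_adjacent_swap:
  assumes "1 \<le> k" "Suc k \<le> n" "inj \<sigma>"
  shows "(- 1 :: 'a :: comm_ring_1) ^ inversions n (\<sigma> \<circ> transpose k (Suc k)) = - ((- 1) ^ inversions n \<sigma>)"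
proof (cases "\<sigma> k < \<sigma> (Suc k)")
  case True
  then show ?thesis
    using inversions_adjacent_swap[of k n \<sigma>] assms by simp
next
  \<comment> \<open>At a descent the roles are exchanged: the swapped map has an ascent at
    \<open>k\<close>, and swapping it again gives back \<open>\<sigma>\<close>.\<close>
  case False
  let ?\<rho> = "\<sigma> \<circ> transpose k (Suc k)"
  have "\<sigma> k \<noteq> \<sigma> (Suc k)"
    using assms(3) by (simp add: inj_eq)
  with False have "?\<rho> k < ?\<rho> (Suc k)" by simp
  moreover have "?\<rho> \<circ> transpose k (Suc k) = \<sigma>"
    by (simp add: comp_assoc)
  ultimately show ?thesis
    using inversions_adjacent_swap[of k n ?\<rho>] assms by simp
qed

definition step_weight :: "'a :: comm_ring_1 \<Rightarrow> 'a \<Rightarrow> nat \<Rightarrow> nat \<Rightarrow> 'a" where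
  "step_weight s t i j = (if i < j then s * t ^ (j - i) else 1)"

lemma prod_step_weight:
  "(\<Prod>i=1..n. step_weight s t i (\<sigma> i)) = s ^ exc n \<sigma> * t ^ depth n \<sigma>"
proof -
  have "(\<Prod>i=1..n. step_weight s t i (\<sigma> i))
      = (\<Prod>i | i \<in> {1..n} \<and> \<sigma> i > i. s * t ^ (\<sigma> i - i))"
    unfolding step_weight_def by (rule prod.inter_filter[symmetric]) simp
  then show ?thesis
    by (simp add: prod.distrib exc_def depth_def power_sum)
qed

definition signed_weight :: "'a :: comm_ring_1 \<Rightarrow> 'a \<Rightarrow> nat \<Rightarrow> (nat \<Rightarrow> nat) \<Rightarrow> 'a" where
  "signed_weight s t n \<sigma> = (- 1) ^ inversions n \<sigma> * (\<Prod>i=1..n. step_weight s t i (\<sigma> i))"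

lemma signed_weight_Suc_permutes:
  assumes "\<sigma> permutes {1..n}"
  shows "signed_weight s t (Suc n) \<sigma> = signed_weight s t n \<sigma>"
  using permutes_not_in[OF assms, of "Suc n"]
  by (simp add: signed_weight_def inversions_Suc_permutes[OF assms] step_weight_def)

text \<open>Only the factors at positions \<open>n\<close> and \<open>Suc n\<close> change. Their
  ratio is expressed by a multiplier \<open>c\<close>, which will be \<open>s * t\<close> for the
  permutations fixing \<open>Suc n\<close> and \<open>1\<close> for the terms that cancel.\<close>

lemma signed_weight_swap_last:
  fixes s t :: "'a :: comm_ring_1"
  assumes "1 \<le> n" "inj \<sigma>"
    and "step_weight s t n (\<sigma> (Suc n)) * step_weight s t (Suc n) (\<sigma> n)
      = c * (step_weight s t n (\<sigma> n) * step_weight s t (Suc n) (\<sigma> (Suc n)))"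
  shows "signed_weight s t (Suc n) (\<sigma> \<circ> transpose n (Suc n)) = - (c * signed_weight s t (Suc n) \<sigma>)"
proof -
  obtain m where n: "n = Suc m"
    using assms(1) by (cases n) auto
  let ?\<rho> = "\<sigma> \<circ> transpose n (Suc n)"
  have "(\<Prod>i=1..m. step_weight s t i (?\<rho> i)) = (\<Prod>i=1..m. step_weight s t i (\<sigma> i))"
    by (rule prod.cong) (auto simp: n transpose_def)
  then have "(\<Prod>i=1..Suc n. step_weight s t i (?\<rho> i)) = c * (\<Prod>i=1..Suc n. step_weight s t i (\<sigma> i))"
    using assms(3) by (simp add: n mult.assoc mult.left_commute)
  then show ?thesis
    unfolding signed_weight_def
    using power_minus_one_inversions_adjacent_swap[where 'a = 'a, of n "Suc n" \<sigma>] assms(1,2)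
    by (simp add: mult.left_commute)
qed

lemma sum_signed_weight_Suc:
  fixes s t :: "'a :: {idom, ring_char_0}"
  assumes n: "1 \<le> n"
  shows "(\<Sum>\<sigma> | \<sigma> permutes {1..Suc n}. signed_weight s t (Suc n) \<sigma>)
    = (1 - s * t) * (\<Sum>\<sigma> | \<sigma> permutes {1..n}. signed_weight s t n \<sigma>)"
proof -
  let ?w = "signed_weight s t (Suc n)"
  let ?\<tau> = "transpose n (Suc n)"
  let ?P = "{\<sigma>. \<sigma> permutes {1..Suc n}}"
  \<comment> \<open>Composition with \<open>?\<tau>\<close> is an involution on \<open>?P\<close>
    that exchanges \<open>?A\<close> with \<open>?B\<close> and maps \<open>?C\<close> to
    itself.\<close>
  let ?A = "{\<sigma> \<in> ?P. \<sigma> (Suc n) = Suc n}"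
  let ?B = "{\<sigma> \<in> ?P. \<sigma> n = Suc n}"
  let ?C = "{\<sigma> \<in> ?P. \<sigma> n \<noteq> Suc n \<and> \<sigma> (Suc n) \<noteq> Suc n}"
  have fin: "finite ?P" by (rule finite_permutations) simp
  have inj: "inj \<sigma>" if "\<sigma> \<in> ?P" for \<sigma>
    using that permutes_inj by blast
  have le: "\<sigma> i \<le> Suc n" if "\<sigma> \<in> ?P" "i \<in> {1..Suc n}" for \<sigma> i
    using that permutes_in_image[of \<sigma> "{1..Suc n}" i] by auto
  have swap: "\<sigma> \<circ> ?\<tau> \<in> ?P" if "\<sigma> \<in> ?P" for \<sigma>
    using that n by (auto intro!: permutes_compose permutes_swap_id)
  have A: "?A = {\<sigma>. \<sigma> permutes {1..n}}"
  proof (intro equalityI subsetI)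
    fix \<sigma> assume "\<sigma> \<in> ?A"
    then have "\<sigma> permutes {1..Suc n}" "\<sigma> (Suc n) = Suc n" by auto
    moreover from this have "\<sigma> i = i" if "i \<in> {1..Suc n} - {1..n}" for i
    proof -
      have "i = Suc n" using that by auto
      then show ?thesis using \<open>\<sigma> (Suc n) = Suc n\<close> by simp
    qed
    ultimately show "\<sigma> \<in> {\<sigma>. \<sigma> permutes {1..n}}"
      using permutes_superset[of \<sigma> "{1..Suc n}" "{1..n}"] by blast
  next
    fix \<sigma> assume "\<sigma> \<in> {\<sigma>. \<sigma> permutes {1..n}}"
    then show "\<sigma> \<in> ?A"
      using permutes_subset[of \<sigma> "{1..n}" "{1..Suc n}"] permutes_not_in[of \<sigma> "{1..n}" "Suc n"]
      by auto
  qed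
  have "\<And>\<sigma>. \<sigma> \<in> ?P \<Longrightarrow> \<not> (\<sigma> n = Suc n \<and> \<sigma> (Suc n) = Suc n)"
    by (metis inj injD n_not_Suc_n)
  then have split: "?P = ?A \<union> (?B \<union> ?C)" "?A \<inter> (?B \<union> ?C) = {}" "?B \<inter> ?C = {}"
    by blast+
  have sumA: "sum ?w ?A = (\<Sum>\<sigma> | \<sigma> permutes {1..n}. signed_weight s t n \<sigma>)"
    unfolding A by (rule sum.cong) (simp_all add: signed_weight_Suc_permutes)
  have "sum ?w ?B = (\<Sum>\<sigma>\<in>?A. ?w (\<sigma> \<circ> ?\<tau>))"
    by (rule sum.reindex_bij_witness[where i = "\<lambda>\<sigma>. \<sigma> \<circ> ?\<tau>" and j = "\<lambda>\<sigma>. \<sigma> \<circ> ?\<tau>"])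
      (use swap in \<open>auto simp: comp_assoc\<close>)
  \<comment> \<open>Before the swap both factors are \<open>1\<close>. Afterwards position
    \<open>n\<close> carries the value \<open>Suc n\<close>, an excedance of size one with factor
    \<open>s * t\<close>, and the other factor remains \<open>1\<close>.\<close>
  also have "\<dots> = (\<Sum>\<sigma>\<in>?A. - (s * t * ?w \<sigma>))"
  proof (rule sum.cong)
    fix \<sigma> assume \<sigma>: "\<sigma> \<in> ?A"
    then have "\<sigma> permutes {1..n}" using A by blast
    then have "\<sigma> n \<le> n" using n permutes_in_image[of \<sigma> "{1..n}" n] by simp
    with \<sigma> n show "?w (\<sigma> \<circ> ?\<tau>) = - (s * t * ?w \<sigma>)"
      by (intro signed_weight_swap_last) (auto simp: inj step_weight_def)
  qed simp
  finally have sumB: "sum ?w ?B = - (s * t * sum ?w ?A)"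
    by (simp add: sum_negf sum_distrib_left)
  have "sum ?w ?C = (\<Sum>\<sigma>\<in>?C. ?w (\<sigma> \<circ> ?\<tau>))"
    by (rule sum.reindex_bij_witness[where i = "\<lambda>\<sigma>. \<sigma> \<circ> ?\<tau>" and j = "\<lambda>\<sigma>. \<sigma> \<circ> ?\<tau>"])
      (use swap in \<open>auto simp: comp_assoc\<close>)
  \<comment> \<open>Both values are at most \<open>n\<close>, so neither position is an excedance
    before or after the swap.\<close>
  also have "\<dots> = (\<Sum>\<sigma>\<in>?C. - (1 * ?w \<sigma>))"
  proof (rule sum.cong)
    fix \<sigma> assume \<sigma>: "\<sigma> \<in> ?C"
    then have "\<sigma> n \<le> n" "\<sigma> (Suc n) \<le> n"
      using le[of \<sigma> n] le[of \<sigma> "Suc n"] n by auto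
    with \<sigma> n show "?w (\<sigma> \<circ> ?\<tau>) = - (1 * ?w \<sigma>)"
      by (intro signed_weight_swap_last) (auto simp: inj step_weight_def)
  qed simp
  finally have "sum ?w ?C = - sum ?w ?C"
    unfolding mult_1_left sum_negf .
  \<comment> \<open>Characteristic 0 and the absence of zero divisors allow the factor 2 to be
    cancelled.\<close>
  then have "2 * sum ?w ?C = 0"
    unfolding eq_neg_iff_add_eq_0 mult_2 .
  then have sumC: "sum ?w ?C = 0"
    by simp
  have "sum ?w ?P = sum ?w (?A \<union> (?B \<union> ?C))"
    by (rule sum.cong[OF split(1) refl])
  also have "\<dots> = sum ?w ?A + sum ?w (?B \<union> ?C)"
    using fin split(2) by (intro sum.union_disjoint) simp_all
  also have "sum ?w (?B \<union> ?C) = sum ?w ?B + sum ?w ?C"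
    using fin split(3) by (intro sum.union_disjoint) simp_all
  finally show ?thesis
    unfolding sumB sumC sumA by (simp add: algebra_simps)
qed

lemma sum_signed_weight:
  fixes s t :: "'a :: {idom, ring_char_0}"
  assumes "1 \<le> n"
  shows "(\<Sum>\<sigma> | \<sigma> permutes {1..n}. signed_weight s t n \<sigma>) = (1 - s * t) ^ (n - 1)"
  using assms
\<comment> \<open>The induction starts at 1 because the recursion fails at 0: the sums for 0 and 1
  are both \<open>1\<close>.\<close>
proof (induction n rule: nat_induct_at_least)
  case base
  have "{(i, j). 1 \<le> i \<and> i < j \<and> j \<le> 1 \<and> i > (j :: nat)} = {}"
    by auto
  then have "inversions 1 (\<lambda>i. i) = 0"
    unfolding inversions_def by (simp only: card.empty)
  then show ?case
    by (simp add: signed_weight_def step_weight_def id_def)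
next
  case (Suc n)
  then show ?case
    using sum_signed_weight_Suc[of n s t] by (cases n) simp_all
qed

theorem theorem1p3:
  fixes n :: nat
  assumes "n \<ge> 1"
  shows "(\<Sum>\<sigma> | \<sigma> permutes {1..n}.
            (-1) ^ inversions n \<sigma> * var_s ^ exc n \<sigma> * var_t ^ depth n \<sigma>)
         = (1 - var_s * var_t) ^ (n - 1)"
  \<comment> \<open>The polynomial ring is an integral domain of characteristic 0, so the general
    identity specializes to the indeterminates.\<close>
  using sum_signed_weight[OF assms, of var_s var_t]
  unfolding signed_weight_def prod_step_weight by (simp only: mult.assoc)

end
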